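(* Let $G$ be a simple connected graph with $n$ vertices, different from the complete graph, and let $H$ be the multigraph obtained from $G$ by adding one new vertex $q$ and joining $q$ to each $v\in V(G)$ by exactly $\operatorname{trs}(v)-\deg(v)$ parallel edges, where $\deg(v)$ and $\operatorname{trs}(v)$ are the degree and the transmission of $v$ in $G$. If the Smith normal form of $A^{\operatorname{trs}}(G)$ is $\operatorname{diag}(f_1,\dots,f_n)$, then the sandpile group $K(H)$ of $H$ is isomorphic to $\mathbb{Z}_{f_1}\oplus\cdots\oplus\mathbb{Z}_{f_n}$, and the number $\tau(H)$ of spanning trees of $H$ equals $\prod_{i=1}^n f_i$.
   Context: For a connected graph $G$, $\operatorname{dist}(u,v)$ is the number of edges in a shortest path between $u$ and $v$, and the transmission of $u$ is $\operatorname{trs}(u)=\sum_{v\in V(G)}\operatorname{dist}(u,v)$ (one always has $\deg(u)\le\operatorname{trs}(u)$). Let $A(G)$ be the adjacency matrix and $\operatorname{trs}(G)$ the diagonal matrix of transmissions; $A^{\operatorname{trs}}(G)=\operatorname{trs}(G)-A(G)$. The Smith normal form (SNF) of a square integer matrix $M$ is the unique diagonal matrix $\operatorname{diag}(f_1,\dots,f_r,0,\dots,0)=PMQ$ with $P,Q\in GL_n(\mathbb{Z})$, $f_i$ positive integers, $f_i\mid f_{i+1}$, and $r$ the rank of $M$. $\mathbb{Z}_f$ denotes $\mathbb{Z}/f\mathbb{Z}$. The sandpile group $K(H)$ of a connected multigraph $H$ is the torsion part of the cokernel $\mathbb{Z}^{V(H)}/\operatorname{im}L(H)$ of its Laplacian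 matrix $L(H)$ (degrees, counted with edge multiplicity, on the diagonal; minus the number of edges between $u$ and $v$ as $uv$-entry for $u\ne v$). Spanning trees of a multigraph are counted with parallel edges regarded as distinct. *)

theory Defs
  imports
    "HOL-Algebra.Product_Groups"
    "Jordan_Normal_Form.DL_Rank"
    "Graph_Theory.Graph_Theory"
begin

section \<open>Distances and transmissions\<close>

text \<open>
  A finite simple graph is a \<open>pair_graph\<close> of the library: a finite, symmetric,
  loop-free set of ordered pairs, each undirected edge being present in both orientations.
  Consequently its degree is the library's out-degree.
\<close>

definition graph_dist :: "'a pair_pre_digraph \<Rightarrow> 'a \<Rightarrow> 'a \<Rightarrow> nat" where
  "graph_dist G u v = (LEAST k. \<exists>p. pre_digraph.apath (with_proj G) u p v \<and> length p = k)"

definition trs :: "'a pair_pre_digraph \<Rightarrow> 'a \<Rightarrow> nat" where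
  "trs G u = (\<Sum>v\<in>pverts G. graph_dist G u v)"

abbreviation deg :: "'a pair_pre_digraph \<Rightarrow> 'a \<Rightarrow> nat" where
  "deg G v \<equiv> out_degree (with_proj G) v"


section \<open>Matrices of a graph\<close>

text \<open>
  The list \<open>vs\<close> enumerates the vertices without repetition; it fixes the order in which
  they index rows and columns.
\<close>

definition adjacency_mat :: "'a pair_pre_digraph \<Rightarrow> 'a list \<Rightarrow> int mat" where
  "adjacency_mat G vs =
     mat (length vs) (length vs) (\<lambda>(i, j). if (vs ! i, vs ! j) \<in> parcs G then 1 else 0)"

definition trs_mat :: "'a pair_pre_digraph \<Rightarrow> 'a list \<Rightarrow> int mat" where
  "trs_mat G vs = mat_diag (length vs) (\<lambda>i. int (trs G (vs ! i)))"

definition A_trs :: "'a pair_pre_digraph \<Rightarrow> 'a list \<Rightarrow> int mat" where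
  "A_trs G vs = trs_mat G vs - adjacency_mat G vs"


section \<open>Smith normal form\<close>

definition int_mat_rank :: "int mat \<Rightarrow> nat" where
  "int_mat_rank M = vec_space.rank (dim_row M) (map_mat rat_of_int M)"

text \<open>
  \<open>D\<close> is the Smith normal form of the square integer matrix \<open>M\<close>.  Invertibility of \<open>P\<close> and
  \<open>Q\<close> is meant over the integers.
\<close>

definition is_smith_normal_form :: "int mat \<Rightarrow> int mat \<Rightarrow> bool" where
  "is_smith_normal_form M D \<longleftrightarrow>
     (let n = dim_row M; r = int_mat_rank M in
        M \<in> carrier_mat n n \<and> D \<in> carrier_mat n n \<and>
        (\<exists>P Q. P \<in> carrier_mat n n \<and> Q \<in> carrier_mat n n \<and>
               invertible_mat P \<and> invertible_mat Q \<and> D = P * M * Q) \<and>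
        diagonal_mat D \<and>
        (\<forall>i<r. D $$ (i, i) > 0) \<and>
        (\<forall>i. Suc i < r \<longrightarrow> D $$ (i, i) dvd D $$ (Suc i, Suc i)) \<and>
        (\<forall>i. r \<le> i \<and> i < n \<longrightarrow> D $$ (i, i) = 0))"


section \<open>Multigraphs\<close>

text \<open>
  Edges are named objects carrying an unordered pair of ends, so parallel edges are distinct.
  The trees of the digraph library cannot be used for these undirected multigraphs: there,
  cycles are directed, and traversing an edge back and forth counts as a cycle.
\<close>

record ('v, 'e) multigraph =
  mverts :: "'v set"
  medges :: "'e set"
  mends  :: "'e \<Rightarrow> 'v set"

definition edges_between :: "('v, 'e) multigraph \<Rightarrow> 'v \<Rightarrow> 'v \<Rightarrow> 'e set" where
  "edges_between H u v = {e \<in> medges H. mends H e = {u, v}}"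

definition mdegree :: "('v, 'e) multigraph \<Rightarrow> 'v \<Rightarrow> nat" where
  "mdegree H u = card {e \<in> medges H. u \<in> mends H e}"

definition laplacian :: "('v, 'e) multigraph \<Rightarrow> 'v \<Rightarrow> 'v \<Rightarrow> int" where
  "laplacian H u v =
     (if u = v then int (mdegree H u) else - int (card (edges_between H u v)))"


subsection \<open>Spanning trees\<close>

definition mconnected :: "('v, 'e) multigraph \<Rightarrow> bool" where
  "mconnected H \<longleftrightarrow> mverts H \<noteq> {} \<and>
     (\<forall>u\<in>mverts H. \<forall>v\<in>mverts H. (u, v) \<in> {(x, y). edges_between H x y \<noteq> {}}\<^sup>*)"

text \<open>
  A cycle visits the distinct vertices \<open>us\<close> in cyclic order along the distinct edges \<open>es\<close>;
  two parallel edges form a cycle of length two.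
\<close>

definition mcycle :: "('v, 'e) multigraph \<Rightarrow> 'v list \<Rightarrow> 'e list \<Rightarrow> bool" where
  "mcycle H us es \<longleftrightarrow>
     es \<noteq> [] \<and> length us = length es \<and> distinct us \<and> distinct es \<and>
     set us \<subseteq> mverts H \<and>
     (\<forall>i<length es. es ! i \<in> edges_between H (us ! i) (us ! (Suc i mod length es)))"

definition mtree :: "('v, 'e) multigraph \<Rightarrow> bool" where
  "mtree H \<longleftrightarrow> mconnected H \<and> (\<nexists>us es. mcycle H us es)"

text \<open>A spanning tree contains all vertices, hence is determined by its set of edges.\<close>

definition num_spanning_trees :: "('v, 'e) multigraph \<Rightarrow> nat" where
  "num_spanning_trees H = card {T. T \<subseteq> medges H \<and> mtree (H\<lparr>medges := T\<rparr>)}"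


subsection \<open>The sandpile group\<close>

definition int_lattice :: "'v set \<Rightarrow> ('v \<Rightarrow> int) monoid" where
  "int_lattice V = product_group V (\<lambda>_. integer_group)"

definition laplacian_image :: "('v, 'e) multigraph \<Rightarrow> ('v \<Rightarrow> int) set" where
  "laplacian_image H =
     (\<lambda>x. \<lambda>u\<in>mverts H. \<Sum>v\<in>mverts H. laplacian H u v * x v) ` carrier (int_lattice (mverts H))"

definition torsion_part :: "('b, 'c) monoid_scheme \<Rightarrow> ('b, 'c) monoid_scheme" where
  "torsion_part A = A\<lparr>carrier := {x \<in> carrier A. \<exists>k::nat. k > 0 \<and> x [^]\<^bsub>A\<^esub> k = \<one>\<^bsub>A\<^esub>}\<rparr>"

definition sandpile_group :: "('v, 'e) multigraph \<Rightarrow> ('v \<Rightarrow> int) set monoid" where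
  "sandpile_group H = torsion_part (int_lattice (mverts H) Mod laplacian_image H)"


section \<open>The coned multigraph\<close>

text \<open>
  The new vertex \<open>q\<close> is \<open>None\<close>.  \<open>Inl {u, v}\<close> is an edge of \<open>G\<close>, and
  \<open>Inr (v, k)\<close> is the \<open>k\<close>-th parallel edge between \<open>q\<close> and \<open>v\<close>.  The subtraction of natural
  numbers does not truncate, since \<open>deg G v \<le> trs G v\<close> in a connected graph.
\<close>

definition cone_multigraph ::
  "'a pair_pre_digraph \<Rightarrow> ('a option, 'a set + 'a \<times> nat) multigraph" where
  "cone_multigraph G =
     \<lparr> mverts = insert None (Some ` pverts G),
       medges = {Inl {u, v} | u v. (u, v) \<in> parcs G} \<union>
                {Inr (v, k) | v k. v \<in> pverts G \<and> k < trs G v - deg G v},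
       mends = (\<lambda>e. case e of Inl s \<Rightarrow> Some ` s | Inr (v, _) \<Rightarrow> {None, Some v}) \<rparr>"

end

theory Submission
  imports Defs "HOL-Library.Transitive_Closure_Table"
begin

text \<open>
  Everything follows from the reduced Laplacian of the coned multigraph \<open>H\<close> at its cone vertex \<open>q\<close>,
  that is, the Laplacian with the row and the column of \<open>q\<close> deleted.  Each \<open>v\<close> is joined to \<open>q\<close> by
  exactly as many edges as are needed to raise its degree from \<open>deg v\<close> to \<open>trs v\<close>, so the reduced
  Laplacian is \<open>A_trs G\<close> (\<open>A_trs_eq_laplacian_cone\<close>).  Two general facts about a finite loopless
  multigraph with a chosen root then give the two claims.

  Counting (\<open>matrix_tree\<close>): the determinant of the reduced Laplacian is the number of spanning trees.
  The row of \<open>u\<close> is a sum over the edges at \<open>u\<close>, so the determinant expands into a sum over all ways of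
  choosing an edge at every non-root vertex.  Such a choice tells every vertex where to go next.  If
  all vertices arrive at the root, the chosen edges form a spanning tree and the summand is 1;
  otherwise some vertices walk around among themselves for ever and the summand is 0.
  Conversely every spanning tree comes from exactly one choice, since its edges can be directed towards
  the root (\<open>spanning_tree_bij\<close>).  In the Smith normal form \<open>P * A_trs * Q\<close> the
  unimodular factors change the determinant only by a sign, hence the product of the \<open>f i\<close> is the
  number of spanning trees.

  Group structure (\<open>sandpile_group_iso_invariant_group\<close>): rows and columns of a Laplacian sum to zero.
  Therefore the image of the full Laplacian consists of the vectors with coordinate sum zero whose
  non-root part lies in the image of the reduced Laplacian, and by the Smith normal form the latter
  condition says that \<open>f i\<close> divides the \<open>i\<close>-th coordinate after multiplication by \<open>P\<close>.
  Sending a vector to its coordinate sum and to these residues thus identifies the cokernel of the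
  Laplacian with the product of \<open>\<int>\<close> with the direct sum of the groups \<open>\<int>\<^bsub>f i\<^esub>\<close>.
  The torsion part is the direct sum, provided that no \<open>f i\<close> vanishes.

  That no \<open>f i\<close> vanishes is where completeness is excluded: if \<open>G\<close> is not complete, then some vertex
  has larger transmission than degree, so \<open>q\<close> is joined to it, \<open>H\<close> is connected and has a
  spanning tree, and the product of the \<open>f i\<close> is positive.
\<close>

section \<open>Spanning trees as choices of edges leading to a root\<close>

lemma mcycle_mono:
  "mcycle (H\<lparr>medges := S\<rparr>) us es \<Longrightarrow> S \<subseteq> T \<Longrightarrow> mcycle (H\<lparr>medges := T\<rparr>) us es"
  unfolding mcycle_def edges_between_def by auto

locale rooted_multigraph =
  fixes H :: "('v, 'e) multigraph" and q :: 'v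
  assumes finite_mverts: "finite (mverts H)"
    and finite_medges: "finite (medges H)"
    and root_in_mverts: "q \<in> mverts H"
    and loopless_ends: "e \<in> medges H \<Longrightarrow> \<exists>u\<in>mverts H. \<exists>v\<in>mverts H. u \<noteq> v \<and> mends H e = {u, v}"
begin

definition nonroot :: "'v set" where
  "nonroot = mverts H - {q}"

definition incident :: "'v \<Rightarrow> 'e set" where
  "incident v = {e \<in> medges H. v \<in> mends H e}"

text \<open>
  A choice gives every non-root vertex one of its edges, to be thought of as the edge along which one
  leaves the vertex.
\<close>
definition choices :: "('v \<Rightarrow> 'e) set" where
  "choices = Pi\<^sub>E nonroot incident"

text \<open>
  Following the chosen edges reaches the root from every vertex iff no nonempty set of non-root
  vertices is closed under the moves.  In this form no iteration of the moves is needed: to refute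
  a configuration it suffices to exhibit a closed set.
\<close>
definition leads_to_root :: "('v \<Rightarrow> 'e) \<Rightarrow> bool" where
  "leads_to_root \<phi> \<longleftrightarrow> (\<forall>S\<subseteq>nonroot. S \<noteq> {} \<longrightarrow> (\<exists>v\<in>S. \<not> mends H (\<phi> v) \<subseteq> S))"

lemma finite_nonroot: "finite nonroot"
  by (simp add: nonroot_def finite_mverts)

lemma finite_incident: "finite (incident v)"
  by (simp add: incident_def finite_medges)

lemma finite_choices: "finite choices"
  by (simp add: choices_def finite_PiE finite_nonroot finite_incident)

lemma other_end:
  assumes "e \<in> incident v"
  obtains w where "w \<in> mverts H" "w \<noteq> v" "mends H e = {v, w}"
proof -
  have e: "e \<in> medges H" "v \<in> mends H e" using assms by (auto simp: incident_def)
  obtain a b where "a \<in> mverts H" "b \<in> mverts H" "a \<noteq> b" "mends H e = {a, b}"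
    using loopless_ends[OF e(1)] by blast
  then show thesis using e(2) that[of a] that[of b] by (cases "v = a") auto
qed

lemma choice_incident: "\<phi> \<in> choices \<Longrightarrow> v \<in> nonroot \<Longrightarrow> \<phi> v \<in> incident v"
  by (auto simp: choices_def)

lemma choice_image_subset: "\<phi> \<in> choices \<Longrightarrow> \<phi> ` nonroot \<subseteq> medges H"
  using choice_incident by (auto simp: incident_def)

text \<open>
  Two vertices with the same chosen edge would be its two ends and form a closed set.
\<close>
lemma leads_to_root_inj_on:
  assumes "\<phi> \<in> choices" "leads_to_root \<phi>"
  shows "inj_on \<phi> nonroot"
proof (rule inj_onI, rule ccontr)
  fix v w assume vw: "v \<in> nonroot" "w \<in> nonroot" "\<phi> v = \<phi> w" "v \<noteq> w"
  obtain x where x: "mends H (\<phi> v) = {v, x}"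
    using other_end[OF choice_incident[OF assms(1) vw(1)]] by metis
  have "w \<in> mends H (\<phi> v)"
    using choice_incident[OF assms(1) vw(2)] vw(3) by (simp add: incident_def)
  then have "mends H (\<phi> v) \<subseteq> {v, w}" using x vw(4) by auto
  then show False
    using assms(2) vw unfolding leads_to_root_def by (metis empty_not_insert empty_subsetI insertE insert_subset singletonD)
qed

text \<open>
  If the choices differ at \<open>v\<close>, then, as both use the same edges, \<open>\<phi> v\<close> is chosen by \<open>\<psi>\<close> at its other end \<open>w\<close>.  They
  differ at \<open>w\<close> too, because \<open>\<phi>\<close> uses the edge only once.  So the vertices where the choices differ form
  a closed set.
\<close>
lemma leads_to_root_inj_image:
  assumes "\<phi> \<in> choices" "leads_to_root \<phi>" "\<psi> \<in> choices" "leads_to_root \<psi>"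
    and img: "\<phi> ` nonroot = \<psi> ` nonroot"
  shows "\<phi> = \<psi>"
proof -
  let ?S = "{v \<in> nonroot. \<phi> v \<noteq> \<psi> v}"
  have "mends H (\<phi> v) \<subseteq> ?S" if v: "v \<in> ?S" for v
  proof -
    have vn: "v \<in> nonroot" using v by simp
    then obtain w where w: "w \<in> nonroot" "\<phi> v = \<psi> w" using img by blast
    have wv: "w \<noteq> v" using v w by auto
    obtain x where x: "mends H (\<phi> v) = {v, x}"
      using other_end[OF choice_incident[OF assms(1) vn]] by metis
    have "w \<in> mends H (\<phi> v)"
      using choice_incident[OF assms(3) w(1)] w(2) by (simp add: incident_def)
    then have ends: "mends H (\<phi> v) = {v, w}" using x wv by auto
    have "\<phi> w \<noteq> \<psi> w"
      using leads_to_root_inj_on[OF assms(1,2)] vn w wv by (metis inj_onD)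
    then show ?thesis using ends v w by auto
  qed
  then have "?S = {}"
    using assms(2) unfolding leads_to_root_def by (metis (no_types, lifting) mem_Collect_eq subsetI)
  then show ?thesis
    using assms(1,3) by (intro PiE_ext[of _ nonroot incident]) (auto simp: choices_def)
qed

text \<open>
  Every vertex chooses an edge towards a vertex closer to the root; a member of a set that is closest
  to the root then leaves the set.
\<close>
lemma connected_imp_leads_to_root:
  assumes "mconnected H"
  obtains \<phi> where "\<phi> \<in> choices" "leads_to_root \<phi>"
proof -
  let ?R = "{(x, y). edges_between H x y \<noteq> {}}"
  \<comment> \<open>the distance from \<open>v\<close> to the root\<close>
  define d where "d v = (LEAST k. (v, q) \<in> ?R ^^ k)" for v
  have conn: "\<exists>k. (v, q) \<in> ?R ^^ k" if "v \<in> mverts H" for v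
    using assms that root_in_mverts unfolding mconnected_def by (meson rtrancl_imp_relpow)
  have step: "\<exists>e w. e \<in> incident v \<and> mends H e = {v, w} \<and> d w < d v" if v: "v \<in> nonroot" for v
  proof -
    have "(v, q) \<in> ?R ^^ d v"
      unfolding d_def using conn[of v] v by (auto simp: nonroot_def intro: LeastI_ex)
    moreover have "v \<noteq> q" using v by (simp add: nonroot_def)
    ultimately obtain k where k: "d v = Suc k" by (cases "d v") auto
    with \<open>(v, q) \<in> ?R ^^ d v\<close> obtain w where w: "(v, w) \<in> ?R" "(w, q) \<in> ?R ^^ k"
      by (metis relpow_Suc_E2)
    then have "d w \<le> k" unfolding d_def by (intro Least_le)
    moreover obtain e where "e \<in> edges_between H v w" using w by auto
    ultimately show ?thesis
      using k by (intro exI[of _ e] exI[of _ w]) (auto simp: edges_between_def incident_def)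
  qed
  then obtain \<psi> where \<psi>: "\<And>v. v \<in> nonroot \<Longrightarrow>
      \<psi> v \<in> incident v \<and> (\<exists>w. mends H (\<psi> v) = {v, w} \<and> d w < d v)"
    by metis
  define \<phi> where "\<phi> = restrict \<psi> nonroot"
  have "\<phi> \<in> choices" using \<psi> by (auto simp: \<phi>_def choices_def)
  moreover have "leads_to_root \<phi>"
    unfolding leads_to_root_def
  proof (intro allI impI)
    fix S assume S: "S \<subseteq> nonroot" "S \<noteq> {}"
    obtain v where v: "v \<in> S" "\<And>w. w \<in> S \<Longrightarrow> d v \<le> d w"
      using S(2) ex_has_least_nat[of "\<lambda>v. v \<in> S" _ d] by blast
    obtain w where w: "mends H (\<phi> v) = {v, w}" "d w < d v"
      using \<psi>[of v] v(1) S(1) unfolding \<phi>_def by (metis restrict_apply' subsetD)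
    then have "\<not> mends H (\<phi> v) \<subseteq> S" using v(2)[of w] by auto
    then show "\<exists>v\<in>S. \<not> mends H (\<phi> v) \<subseteq> S" using v(1) by blast
  qed
  ultimately show thesis by (rule that)
qed

text \<open>
  The vertices that cannot reach the root along chosen edges form a closed set.
\<close>
lemma leads_to_root_connected:
  assumes "\<phi> \<in> choices" "leads_to_root \<phi>"
  shows "mconnected (H\<lparr>medges := \<phi> ` nonroot\<rparr>)"
proof -
  let ?H' = "H\<lparr>medges := \<phi> ` nonroot\<rparr>"
  let ?R = "{(x, y). edges_between ?H' x y \<noteq> {}}"
  have "sym ?R" by (auto simp: sym_def edges_between_def insert_commute)
  then have sym: "sym (?R\<^sup>*)" by (rule sym_rtrancl)
  let ?S = "{v \<in> nonroot. (v, q) \<notin> ?R\<^sup>*}"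
  have "mends H (\<phi> v) \<subseteq> ?S" if v: "v \<in> ?S" for v
  proof -
    obtain w where w: "w \<in> mverts H" "mends H (\<phi> v) = {v, w}"
      using other_end[OF choice_incident[OF assms(1)]] v by (metis (no_types, lifting) mem_Collect_eq)
    have "(v, w) \<in> ?R" using v w by (auto simp: edges_between_def)
    then have "(w, q) \<notin> ?R\<^sup>*" using v by (metis (no_types, lifting) mem_Collect_eq converse_rtrancl_into_rtrancl)
    then show ?thesis using v w by (auto simp: nonroot_def)
  qed
  then have "?S = {}"
    using assms(2) unfolding leads_to_root_def by (metis (no_types, lifting) mem_Collect_eq subsetI)
  then have "(v, q) \<in> ?R\<^sup>*" if "v \<in> mverts H" for v
    using that by (cases "v = q") (auto simp: nonroot_def)
  then have "(u, v) \<in> ?R\<^sup>*" if "u \<in> mverts H" "v \<in> mverts H" for u v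
    using that sym by (meson rtrancl_trans symD)
  then show ?thesis using root_in_mverts by (auto simp: mconnected_def)
qed

text \<open>
  The \<open>k\<close> edges of a cycle of chosen edges are chosen at vertices of the cycle, of which there are
  also \<open>k\<close>.  By counting, each vertex of the cycle has chosen an edge of the cycle, so the cycle is a
  closed set.
\<close>
lemma leads_to_root_acyclic:
  assumes "\<phi> \<in> choices" "leads_to_root \<phi>"
  shows "\<not> mcycle (H\<lparr>medges := \<phi> ` nonroot\<rparr>) us es"
proof
  assume cyc: "mcycle (H\<lparr>medges := \<phi> ` nonroot\<rparr>) us es"
  have es_ends: "e \<in> \<phi> ` nonroot \<and> mends H e \<subseteq> set us" if "e \<in> set es" for e
  proof -
    obtain i where i: "i < length es" "e = es ! i" using \<open>e \<in> set es\<close> by (metis in_set_conv_nth)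
    have "Suc i mod length es < length es" using i(1) by (intro mod_less_divisor) auto
    then show ?thesis using cyc i by (auto simp: mcycle_def edges_between_def)
  qed
  let ?W = "{w \<in> nonroot. \<phi> w \<in> set es}"
  have sub: "?W \<subseteq> set us"
    using es_ends choice_incident[OF assms(1)] by (auto simp: incident_def)
  have "set es \<subseteq> \<phi> ` ?W" using es_ends by auto
  then have "card (set es) \<le> card ?W"
    by (intro surj_card_le) (auto simp: finite_nonroot)
  moreover have "card (set es) = card (set us)"
    using cyc by (simp add: mcycle_def distinct_card)
  ultimately have W: "?W = set us" using sub by (intro card_seteq) auto
  then have "set us \<subseteq> nonroot" "\<And>w. w \<in> set us \<Longrightarrow> mends H (\<phi> w) \<subseteq> set us"
    using es_ends by blast+
  moreover have "set us \<noteq> {}" using cyc by (auto simp: mcycle_def)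
  ultimately show False using assms(2) unfolding leads_to_root_def by blast
qed

text \<open>
  The additional edge closes a simple path between its ends.
\<close>
lemma path_plus_edge_cycle:
  assumes T: "T \<subseteq> medges H" and e: "e \<in> medges H" "e \<notin> T"
    and conn: "mconnected (H\<lparr>medges := T\<rparr>)"
  shows "\<exists>us es. mcycle (H\<lparr>medges := insert e T\<rparr>) us es"
proof -
  let ?r = "\<lambda>x y. edges_between (H\<lparr>medges := T\<rparr>) x y \<noteq> {}"
  obtain x y where xy: "x \<in> mverts H" "y \<in> mverts H" "x \<noteq> y" "mends H e = {x, y}"
    using loopless_ends[OF e(1)] by blast
  have "(x, y) \<in> {(x, y). ?r x y}\<^sup>*" using conn xy by (auto simp: mconnected_def)
  then have "?r\<^sup>*\<^sup>* x y" by (simp add: rtranclp_rtrancl_eq)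
  then obtain xs0 where "rtrancl_path ?r x xs0 y" by (auto simp: rtranclp_eq_rtrancl_path)
  then obtain xs where xs: "rtrancl_path ?r x xs y" "distinct (x # xs)"
    by (rule rtrancl_path_distinct)
  have ne: "xs \<noteq> []" using xs(1) xy(3) by (auto elim: rtrancl_path.cases)
  let ?n = "length xs" and ?us = "x # xs"
  have last: "?us ! ?n = y" using rtrancl_path_last[OF xs(1) ne] ne by (simp add: last_conv_nth nth_Cons')
  have "\<exists>f. f \<in> T \<and> mends H f = {?us ! i, ?us ! Suc i}" if "i < ?n" for i
    using rtrancl_path_nth[OF xs(1) that] by (auto simp: edges_between_def)
  then obtain g where g: "\<And>i. i < ?n \<Longrightarrow> g i \<in> T \<and> mends H (g i) = {?us ! i, ?us ! Suc i}"
    by metis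
  define es where "es = map g [0..<?n] @ [e]"
  have us_inj: "?us ! i = ?us ! j \<longleftrightarrow> i = j" if "i \<le> ?n" "j \<le> ?n" for i j
    using nth_eq_iff_index_eq[OF xs(2), of i j] that by simp
  have "inj_on g {0..<?n}"
  proof (rule inj_onI)
    fix i j assume ij: "i \<in> {0..<?n}" "j \<in> {0..<?n}" "g i = g j"
    then have "{?us ! i, ?us ! Suc i} = {?us ! j, ?us ! Suc j}" using g[of i] g[of j] by auto
    then show "i = j"
      using ij us_inj[of i j] us_inj[of i "Suc j"] us_inj[of "Suc i" j] by (auto simp: doubleton_eq_iff)
  qed
  moreover have "e \<notin> g ` {0..<?n}" using g e by auto
  ultimately have "distinct es" by (auto simp: es_def distinct_map)
  moreover have "set ?us \<subseteq> mverts H"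
  proof -
    have "?us ! i \<in> mverts H" if "i \<le> ?n" for i
    proof (cases i)
      case 0 then show ?thesis using xy by simp
    next
      case (Suc k)
      then have "g k \<in> medges H" "mends H (g k) = {?us ! k, ?us ! i}" using g[of k] T that by auto
      then show ?thesis using loopless_ends[of "g k"] by (auto simp: doubleton_eq_iff)
    qed
    then show ?thesis by (metis in_set_conv_nth length_Cons less_Suc_eq_le subsetI)
  qed
  moreover have "es ! i \<in> edges_between (H\<lparr>medges := insert e T\<rparr>) (?us ! i) (?us ! (Suc i mod length es))"
    if "i < length es" for i
  proof (cases "i < ?n")
    case True
    then have "es ! i = g i" "Suc i mod length es = Suc i" by (auto simp: es_def nth_append)
    then show ?thesis using g[OF True] by (simp only: edges_between_def) auto
  next
    case False
    then have i: "i = ?n" using that by (simp add: es_def)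
    have "es ! i = e" "Suc i mod length es = 0" by (auto simp: i es_def nth_append)
    then show ?thesis using xy last i by (simp only: edges_between_def) auto
  qed
  ultimately have "mcycle (H\<lparr>medges := insert e T\<rparr>) ?us es"
    using xs(2) unfolding mcycle_def by (auto simp: es_def)
  then show ?thesis by blast
qed

text \<open>
  For surjectivity, a spanning tree \<open>T\<close> is connected and hence contains the edges of some choice that
  leads to the root.  These edges already connect all vertices, so any further edge of \<open>T\<close> would
  close a cycle in \<open>T\<close>.
\<close>
theorem spanning_tree_bij:
  "bij_betw (\<lambda>\<phi>. \<phi> ` nonroot) {\<phi> \<in> choices. leads_to_root \<phi>}
     {T. T \<subseteq> medges H \<and> mtree (H\<lparr>medges := T\<rparr>)}"
proof (rule bij_betw_imageI)
  show "inj_on (\<lambda>\<phi>. \<phi> ` nonroot) {\<phi> \<in> choices. leads_to_root \<phi>}"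
    using leads_to_root_inj_image by (auto simp: inj_on_def)
  show "(\<lambda>\<phi>. \<phi> ` nonroot) ` {\<phi> \<in> choices. leads_to_root \<phi>} =
      {T. T \<subseteq> medges H \<and> mtree (H\<lparr>medges := T\<rparr>)}" (is "?L = ?R")
  proof
    show "?L \<subseteq> ?R"
      using choice_image_subset leads_to_root_connected leads_to_root_acyclic
      by (auto simp: mtree_def)
    show "?R \<subseteq> ?L"
    proof
      fix T assume "T \<in> ?R"
      then have T: "T \<subseteq> medges H" and conn: "mconnected (H\<lparr>medges := T\<rparr>)"
        and acyc: "\<And>us es. \<not> mcycle (H\<lparr>medges := T\<rparr>) us es"
        by (auto simp: mtree_def)
      interpret sub: rooted_multigraph "H\<lparr>medges := T\<rparr>" q
        using finite_mverts finite_medges root_in_mverts loopless_ends T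
        by unfold_locales (auto intro: finite_subset)
      obtain \<phi> where \<phi>: "\<phi> \<in> sub.choices" "sub.leads_to_root \<phi>"
        using sub.connected_imp_leads_to_root[OF conn] .
      have nr: "sub.nonroot = nonroot" by (simp add: sub.nonroot_def nonroot_def)
      have "\<phi> \<in> choices" "\<phi> ` nonroot \<subseteq> T"
        using \<phi>(1) T unfolding choices_def sub.choices_def nr
        by (auto simp: PiE_iff incident_def sub.incident_def)
      moreover have lead: "leads_to_root \<phi>"
        using \<phi>(2) by (simp add: leads_to_root_def sub.leads_to_root_def nr)
      moreover have "T \<subseteq> \<phi> ` nonroot"
      proof (rule subsetI, rule ccontr)
        fix e assume e: "e \<in> T" "e \<notin> \<phi> ` nonroot"
        obtain us es where "mcycle (H\<lparr>medges := insert e (\<phi> ` nonroot)\<rparr>) us es"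
          using path_plus_edge_cycle[OF choice_image_subset[OF \<open>\<phi> \<in> choices\<close>] _ e(2)
              leads_to_root_connected[OF \<open>\<phi> \<in> choices\<close> lead]] e(1) T by blast
        then have "mcycle (H\<lparr>medges := T\<rparr>) us es"
          by (rule mcycle_mono) (use e(1) \<open>\<phi> ` nonroot \<subseteq> T\<close> in auto)
        then show False using acyc by blast
      qed
      ultimately show "T \<in> ?L" by blast
    qed
  qed
qed

end

section \<open>The matrix-tree theorem\<close>

lemma det_expand_row_sums:
  fixes g :: "nat \<Rightarrow> 'e \<Rightarrow> nat \<Rightarrow> 'a :: comm_ring_1"
  assumes fin: "\<And>i. i < n \<Longrightarrow> finite (E i)"
  shows "det (mat n n (\<lambda>(i, j). \<Sum>e\<in>E i. g i e j)) =
    (\<Sum>c\<in>Pi\<^sub>E {0..<n} E. det (mat n n (\<lambda>(i, j). g i (c i) j)))"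
proof -
  let ?P = "{p. p permutes {0..<n}}"
  have "det (mat n n (\<lambda>(i, j). \<Sum>e\<in>E i. g i e j)) =
      (\<Sum>p\<in>?P. signof p * (\<Prod>i = 0..<n. \<Sum>e\<in>E i. g i e (p i)))"
    by (subst det_def'[of _ n])
       (auto intro!: sum.cong arg_cong2[where f = "(*)"] prod.cong simp: permutes_in_image[where S = "{0..<n}", simplified])
  also have "\<dots> = (\<Sum>p\<in>?P. \<Sum>c\<in>Pi\<^sub>E {0..<n} E. signof p * (\<Prod>i = 0..<n. g i (c i) (p i)))"
    by (subst prod_sum_PiE) (auto simp: fin sum_distrib_left)
  also have "\<dots> = (\<Sum>c\<in>Pi\<^sub>E {0..<n} E. \<Sum>p\<in>?P. signof p * (\<Prod>i = 0..<n. g i (c i) (p i)))"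
    by (rule sum.swap)
  also have "\<dots> = (\<Sum>c\<in>Pi\<^sub>E {0..<n} E. det (mat n n (\<lambda>(i, j). g i (c i) j)))"
    by (intro sum.cong refl, subst det_def'[of _ n])
       (auto intro!: sum.cong arg_cong2[where f = "(*)"] prod.cong simp: permutes_in_image[where S = "{0..<n}", simplified])
  finally show ?thesis .
qed

context rooted_multigraph
begin

text \<open>
  The identity minus the matrix of the map that moves each vertex to the other end of its chosen
  edge, a move to the root being the zero row.
\<close>
definition choice_mat :: "'v list \<Rightarrow> ('v \<Rightarrow> 'e) \<Rightarrow> int mat" where
  "choice_mat vs \<phi> = mat (length vs) (length vs) (\<lambda>(i, j).
     if i = j then 1 else if vs ! j \<in> mends H (\<phi> (vs ! i)) then - 1 else 0)"

lemma laplacian_sum_incident: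
  "laplacian H u v = (\<Sum>e\<in>incident u. if u = v then 1 else if v \<in> mends H e then - 1 else 0)"
proof (cases "u = v")
  case True
  then show ?thesis by (simp add: laplacian_def mdegree_def incident_def)
next
  case False
  have "edges_between H u v = incident u \<inter> {e. v \<in> mends H e}"
  proof
    show "edges_between H u v \<subseteq> incident u \<inter> {e. v \<in> mends H e}"
      by (auto simp: edges_between_def incident_def)
    show "incident u \<inter> {e. v \<in> mends H e} \<subseteq> edges_between H u v"
    proof
      fix e assume e: "e \<in> incident u \<inter> {e. v \<in> mends H e}"
      then obtain w where "mends H e = {u, w}" using other_end[of e u] by blast
      then show "e \<in> edges_between H u v"
        using e False by (auto simp: edges_between_def incident_def)
    qed
  qed
  moreover have "(\<Sum>e\<in>incident u. if v \<in> mends H e then - 1 else 0) = - int (card (incident u \<inter> {e. v \<in> mends H e}))"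
    by (simp add: sum.If_cases[OF finite_incident])
  ultimately show ?thesis using False by (simp add: laplacian_def)
qed

context
  fixes vs :: "'v list"
  assumes distinct_vs: "distinct vs" and set_vs: "set vs = nonroot"
begin

lemma nth_nonroot: "i < length vs \<Longrightarrow> vs ! i \<in> nonroot"
  by (metis nth_mem set_vs)

lemma nth_inj: "i < length vs \<Longrightarrow> j < length vs \<Longrightarrow> vs ! i = vs ! j \<longleftrightarrow> i = j"
  using distinct_vs by (simp add: nth_eq_iff_index_eq)

text \<open>
  In the Leibniz formula only the identity contributes: if all factors of another permutation are
  nonzero, then each vertex that it displaces is sent along its chosen edge, to a
  vertex that is displaced again, so the displaced vertices form a closed set.
\<close>
lemma det_choice_mat_leads_to_root:
  assumes \<phi>: "\<phi> \<in> choices" "leads_to_root \<phi>"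
  shows "det (choice_mat vs \<phi>) = 1"
proof -
  let ?n = "length vs" and ?A = "choice_mat vs \<phi>"
  have A: "?A \<in> carrier_mat ?n ?n" by (simp add: choice_mat_def)
  have zero: "(\<Prod>i = 0..<?n. ?A $$ (i, p i)) = 0" if p: "p permutes {0..<?n}" and "p \<noteq> id" for p
  proof (rule ccontr)
    assume nz: "(\<Prod>i = 0..<?n. ?A $$ (i, p i)) \<noteq> 0"
    let ?M = "{i \<in> {0..<?n}. p i \<noteq> i}"
    let ?S = "(!) vs ` ?M"
    obtain i where "p i \<noteq> i" using \<open>p \<noteq> id\<close> by (auto simp: fun_eq_iff)
    moreover then have "i \<in> {0..<?n}" using p by (metis permutes_not_in)
    ultimately have "?M \<noteq> {}" by blast
    moreover have "mends H (\<phi> v) \<subseteq> ?S" if v: "v \<in> ?S" for v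
    proof -
      obtain i where "i \<in> ?M" and iv: "v = vs ! i" using v by blast
      then have i: "i < ?n" "p i \<noteq> i" "v = vs ! i" by simp_all
      have pi: "p i < ?n" using p i(1) by (simp add: permutes_in_image[where S = "{0..<?n}", simplified])
      have "?A $$ (i, p i) \<noteq> 0" using nz i(1) by (simp add: prod_zero_iff)
      then have mem: "vs ! p i \<in> mends H (\<phi> v)"
        using i pi by (auto simp: choice_mat_def split: if_splits)
      obtain w where w: "mends H (\<phi> v) = {v, w}"
        using other_end[OF choice_incident[OF \<phi>(1) nth_nonroot[OF i(1)]]] i(3) by metis
      have "vs ! p i \<noteq> v" using i pi by (simp add: nth_inj)
      then have ends: "mends H (\<phi> v) = {v, vs ! p i}" using mem w by auto
      have "p (p i) \<noteq> p i" using p i(2) by (metis permutes_inj injD)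
      then have "i \<in> ?M" "p i \<in> ?M" using i pi by simp_all
      then have "{v, vs ! p i} \<subseteq> ?S" unfolding i(3) by blast
      then show ?thesis by (simp only: ends)
    qed
    moreover have "?S \<subseteq> nonroot" using nth_nonroot by auto
    ultimately show False
      using \<phi>(2)[unfolded leads_to_root_def, rule_format, of ?S] by blast
  qed
  have "det ?A = (\<Sum>p\<in>{p. p permutes {0..<?n}}. signof p * (\<Prod>i = 0..<?n. ?A $$ (i, p i)))"
    by (rule det_def'[OF A])
  also have "\<dots> = (\<Sum>p\<in>{id}. signof p * (\<Prod>i = 0..<?n. ?A $$ (i, p i)))"
    using zero by (intro sum.mono_neutral_right) (auto simp: finite_permutations permutes_id)
  also have "\<dots> = 1" by (simp add: choice_mat_def)
  finally show ?thesis .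
qed

text \<open>
  The union \<open>M\<close> of all closed sets is closed, and it is maximal, so a vertex that moves into \<open>M\<close> belongs
  to \<open>M\<close>.  Hence the indicator vector of \<open>M\<close> takes the same value at a vertex and at the vertex to
  which it moves, and lies in the kernel.
\<close>
lemma det_choice_mat_not_leads_to_root:
  assumes \<phi>: "\<phi> \<in> choices" "\<not> leads_to_root \<phi>"
  shows "det (choice_mat vs \<phi>) = 0"
proof -
  let ?n = "length vs" and ?A = "choice_mat vs \<phi>"
  have A: "?A \<in> carrier_mat ?n ?n" by (simp add: choice_mat_def)
  define closed where "closed S \<longleftrightarrow> S \<subseteq> nonroot \<and> (\<forall>v\<in>S. mends H (\<phi> v) \<subseteq> S)" for S
  define M where "M = \<Union>{S. closed S}"
  have M: "closed M" unfolding M_def closed_def by blast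
  have "M \<noteq> {}" using \<phi>(2) unfolding leads_to_root_def M_def closed_def by auto
  let ?x = "vec ?n (\<lambda>j. if vs ! j \<in> M then 1 else 0 :: int)"
  have "?A *\<^sub>v ?x = 0\<^sub>v ?n"
  proof (rule eq_vecI)
    show "dim_vec (?A *\<^sub>v ?x) = dim_vec (0\<^sub>v ?n)" using A by simp
    fix i assume "i < dim_vec (0\<^sub>v ?n :: int vec)"
    then have i: "i < ?n" by simp
    let ?v = "vs ! i"
    obtain w where w: "w \<in> mverts H" "w \<noteq> ?v" "mends H (\<phi> ?v) = {?v, w}"
      using other_end[OF choice_incident[OF \<phi>(1) nth_nonroot[OF i]]] .
    have iff: "?v \<in> M \<longleftrightarrow> w \<in> M"
    proof
      assume "w \<in> M"
      then have "closed (insert ?v M)" using M w nth_nonroot[OF i] by (auto simp: closed_def)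
      then show "?v \<in> M" by (auto simp: M_def)
    qed (use M w in \<open>auto simp: closed_def\<close>)
    have "(?A *\<^sub>v ?x) $ i = (\<Sum>j = 0..<?n. (if i = j then if vs ! j \<in> M then 1 else 0 else 0)
        - (if vs ! j = w then if vs ! j \<in> M then 1 else 0 else 0))"
      using i w by (simp add: choice_mat_def scalar_prod_def, intro sum.cong) (auto simp: nth_inj)
    also have "\<dots> = (if ?v \<in> M then 1 else 0) - (\<Sum>j = 0..<?n. if vs ! j = w then if vs ! j \<in> M then 1 else 0 else 0)"
      using i by (simp add: sum_subtractf)
    also have "(\<Sum>j = 0..<?n. if vs ! j = w then if vs ! j \<in> M then 1 else 0 else 0) = (if w \<in> M then 1 else 0 :: int)"
    proof (cases "w \<in> M")
      case True
      then have "w \<in> set vs" using M set_vs by (auto simp: closed_def)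
      then obtain k where k: "k < ?n" "w = vs ! k" by (auto simp: in_set_conv_nth)
      have "(\<Sum>j = 0..<?n. if vs ! j = w then if vs ! j \<in> M then 1 else 0 else 0) = (\<Sum>j = 0..<?n. if j = k then 1 else 0 :: int)"
        using k True by (intro sum.cong) (auto simp: nth_inj)
      then show ?thesis using k True by simp
    next
      case False
      then show ?thesis by (auto intro!: sum.neutral)
    qed
    finally show "(?A *\<^sub>v ?x) $ i = 0\<^sub>v ?n $ i" using i iff by simp
  qed
  moreover have "?x \<noteq> 0\<^sub>v ?n"
  proof -
    obtain v where "v \<in> M" using \<open>M \<noteq> {}\<close> by blast
    moreover then have "v \<in> set vs" using M set_vs by (auto simp: closed_def)
    ultimately obtain k where "k < ?n" "vs ! k \<in> M" by (auto simp: in_set_conv_nth)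
    then have "?x $ k \<noteq> 0\<^sub>v ?n $ k" by simp
    then show ?thesis by metis
  qed
  ultimately show ?thesis using det_0_iff_vec_prod_zero[OF A] by (metis vec_carrier)
qed

theorem matrix_tree:
  "det (mat (length vs) (length vs) (\<lambda>(i, j). laplacian H (vs ! i) (vs ! j))) = int (num_spanning_trees H)"
proof -
  let ?n = "length vs"
  let ?g = "\<lambda>i e j. if i = j then 1 else if vs ! j \<in> mends H e then - 1 else 0 :: int"
  have inj: "inj_on ((!) vs) {0..<?n}" using distinct_vs by (simp add: inj_on_nth)
  have img: "(!) vs ` {0..<?n} = nonroot" using nth_image[of ?n vs] set_vs by simp
  have inv: "inv_into {0..<?n} ((!) vs) (vs ! i) = i" if "i < ?n" for i
    using inv_into_f_f[OF inj] that by simp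
  have inv': "vs ! inv_into {0..<?n} ((!) vs) v = v" "inv_into {0..<?n} ((!) vs) v < ?n"
    if "v \<in> nonroot" for v
    using that f_inv_into_f[of v "(!) vs" "{0..<?n}"] inv_into_into[of v "(!) vs" "{0..<?n}"] img by auto
  have "mat ?n ?n (\<lambda>(i, j). laplacian H (vs ! i) (vs ! j)) =
      mat ?n ?n (\<lambda>(i, j). \<Sum>e\<in>incident (vs ! i). ?g i e j)"
    by (rule eq_matI) (auto simp: laplacian_sum_incident nth_inj)
  then have "det (mat ?n ?n (\<lambda>(i, j). laplacian H (vs ! i) (vs ! j))) =
      (\<Sum>c\<in>Pi\<^sub>E {0..<?n} (\<lambda>i. incident (vs ! i)). det (mat ?n ?n (\<lambda>(i, j). ?g i (c i) j)))"
    by (simp only: det_expand_row_sums[where n = ?n and g = ?g] finite_incident)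
  also have "\<dots> = (\<Sum>\<phi>\<in>choices. det (choice_mat vs \<phi>))"
  proof (rule sum.reindex_bij_witness[where i = "\<lambda>\<phi>. \<lambda>i\<in>{0..<?n}. \<phi> (vs ! i)"
        and j = "\<lambda>c. \<lambda>v\<in>nonroot. c (inv_into {0..<?n} ((!) vs) v)"])
    fix c assume c: "c \<in> Pi\<^sub>E {0..<?n} (\<lambda>i. incident (vs ! i))"
    let ?j = "\<lambda>v\<in>nonroot. c (inv_into {0..<?n} ((!) vs) v)"
    show "(\<lambda>i\<in>{0..<?n}. ?j (vs ! i)) = c"
      by (rule PiE_ext[OF _ c]) (use c in \<open>auto simp: inv nth_nonroot\<close>)
    show "?j \<in> choices"
      unfolding choices_def restrict_PiE_iff
    proof
      fix v assume v: "v \<in> nonroot"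
      show "c (inv_into {0..<?n} ((!) vs) v) \<in> incident v"
        using PiE_mem[OF c, of "inv_into {0..<?n} ((!) vs) v"] inv'[OF v] by simp
    qed
    show "det (choice_mat vs ?j) = det (mat ?n ?n (\<lambda>(i, j). ?g i (c i) j))"
      unfolding choice_mat_def by (rule arg_cong[of _ _ det], rule eq_matI) (auto simp: inv nth_nonroot)
  next
    fix \<phi> assume \<phi>: "\<phi> \<in> choices"
    let ?c = "\<lambda>i\<in>{0..<?n}. \<phi> (vs ! i)"
    show "(\<lambda>v\<in>nonroot. ?c (inv_into {0..<?n} ((!) vs) v)) = \<phi>"
      using \<phi> by (intro PiE_ext[of _ nonroot incident]) (auto simp: choices_def inv')
    show "?c \<in> Pi\<^sub>E {0..<?n} (\<lambda>i. incident (vs ! i))"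
      using \<phi> choice_incident nth_nonroot by auto
  qed
  also have "\<dots> = (\<Sum>\<phi>\<in>choices. if leads_to_root \<phi> then 1 else 0)"
    by (intro sum.cong) (auto simp: det_choice_mat_leads_to_root det_choice_mat_not_leads_to_root)
  also have "\<dots> = int (card {\<phi> \<in> choices. leads_to_root \<phi>})"
    by (simp add: sum.If_cases[OF finite_choices] Int_def)
  also have "card {\<phi> \<in> choices. leads_to_root \<phi>} = num_spanning_trees H"
    using bij_betw_same_card[OF spanning_tree_bij] by (simp add: num_spanning_trees_def)
  finally show ?thesis .
qed

end

lemma num_spanning_trees_pos:
  assumes "mconnected H"
  shows "num_spanning_trees H > 0"
proof -
  obtain \<phi> where "\<phi> \<in> choices" "leads_to_root \<phi>"
    using connected_imp_leads_to_root[OF assms] .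
  then have "\<phi> ` nonroot \<in> {T. T \<subseteq> medges H \<and> mtree (H\<lparr>medges := T\<rparr>)}"
    by (intro bij_betw_apply[OF spanning_tree_bij]) simp
  then have "{T. T \<subseteq> medges H \<and> mtree (H\<lparr>medges := T\<rparr>)} \<noteq> {}" by blast
  moreover have "finite {T. T \<subseteq> medges H \<and> mtree (H\<lparr>medges := T\<rparr>)}"
    by (rule finite_subset[of _ "Pow (medges H)"]) (auto simp: finite_medges)
  ultimately show ?thesis by (simp add: num_spanning_trees_def card_gt_0_iff)
qed

end

section \<open>The sandpile group from a diagonalised reduced Laplacian\<close>

lemma mult_torsion_part [simp]: "monoid.mult (torsion_part A) = monoid.mult A"
  by (simp add: torsion_part_def)

lemma torsion_part_iso:
  assumes "group A" "group B" and h: "h \<in> iso A B"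
  shows "h \<in> iso (torsion_part A) (torsion_part B)"
proof -
  interpret group_hom A B h
    using assms by (simp add: group_hom_def group_hom_axioms_def iso_def)
  have inj: "inj_on h (carrier A)" and surj: "h ` carrier A = carrier B"
    using h by (auto simp: iso_def bij_betw_def)
  have pow: "h x [^]\<^bsub>B\<^esub> k = \<one>\<^bsub>B\<^esub> \<longleftrightarrow> x [^]\<^bsub>A\<^esub> k = \<one>\<^bsub>A\<^esub>" if "x \<in> carrier A" for x and k :: nat
    using that inj by (metis G.nat_pow_closed G.one_closed hom_nat_pow hom_one inj_onD)
  have "h ` carrier (torsion_part A) = carrier (torsion_part B)"
  proof
    show "h ` carrier (torsion_part A) \<subseteq> carrier (torsion_part B)"
      using pow by (auto simp: torsion_part_def)
    show "carrier (torsion_part B) \<subseteq> h ` carrier (torsion_part A)"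
    proof
      fix y assume y: "y \<in> carrier (torsion_part B)"
      then have "y \<in> h ` carrier A" by (simp add: torsion_part_def surj)
      then obtain x where x: "x \<in> carrier A" "y = h x" by blast
      then have "x \<in> carrier (torsion_part A)" using y pow by (auto simp: torsion_part_def)
      then show "y \<in> h ` carrier (torsion_part A)" using x(2) by blast
    qed
  qed
  moreover have "inj_on h (carrier (torsion_part A))"
    by (rule inj_on_subset[OF inj]) (auto simp: torsion_part_def)
  moreover have "h (x \<otimes>\<^bsub>A\<^esub> y) = h x \<otimes>\<^bsub>B\<^esub> h y"
    if "x \<in> carrier (torsion_part A)" "y \<in> carrier (torsion_part A)" for x y
    using that by (simp add: torsion_part_def)
  ultimately show ?thesis
    by (auto simp: iso_def hom_def bij_betw_def)
qed

text \<open>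
  Powers in a finite group repeat, so all its elements are torsion, whereas 0 is the only torsion
  element of the integers.
\<close>
lemma torsion_part_int_times_finite:
  assumes "group B" "finite (carrier B)"
  shows "snd \<in> iso (torsion_part (integer_group \<times>\<times> B)) B"
proof -
  interpret B: group B by fact
  have pow: "(a, b) [^]\<^bsub>integer_group \<times>\<times> B\<^esub> k = (int k * a, b [^]\<^bsub>B\<^esub> k)" for a b and k :: nat
    by (induction k) (auto simp: algebra_simps)
  have "\<exists>k>0. b [^]\<^bsub>B\<^esub> (k :: nat) = \<one>\<^bsub>B\<^esub>" if b: "b \<in> carrier B" for b
  proof -
    have "range (\<lambda>k :: nat. b [^]\<^bsub>B\<^esub> k) \<subseteq> carrier B" using b by auto
    then have "\<not> inj (\<lambda>k :: nat. b [^]\<^bsub>B\<^esub> k)"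
      using assms(2) finite_imageD finite_subset infinite_UNIV_nat by blast
    then obtain i j :: nat where ij: "i < j" "b [^]\<^bsub>B\<^esub> i = b [^]\<^bsub>B\<^esub> j"
      using linorder_injI by blast
    have "b [^]\<^bsub>B\<^esub> i \<otimes>\<^bsub>B\<^esub> b [^]\<^bsub>B\<^esub> (j - i) = b [^]\<^bsub>B\<^esub> j"
      using b ij(1) by (simp add: B.nat_pow_mult)
    then have "b [^]\<^bsub>B\<^esub> i \<otimes>\<^bsub>B\<^esub> b [^]\<^bsub>B\<^esub> (j - i) = b [^]\<^bsub>B\<^esub> i"
      by (simp only: ij(2))
    then have "b [^]\<^bsub>B\<^esub> (j - i) = \<one>\<^bsub>B\<^esub>" using b by simp
    then show ?thesis using ij(1) by (intro exI[of _ "j - i"]) simp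
  qed
  then have mem: "(a, b) \<in> carrier (torsion_part (integer_group \<times>\<times> B)) \<longleftrightarrow>
      (a, b) \<in> {0} \<times> carrier B" for a b
    by (auto simp: torsion_part_def pow)
  have carrier: "carrier (torsion_part (integer_group \<times>\<times> B)) = {0} \<times> carrier B"
  proof (rule Set.set_eqI)
    fix x show "x \<in> carrier (torsion_part (integer_group \<times>\<times> B)) \<longleftrightarrow> x \<in> {0} \<times> carrier B"
      by (cases x) (simp only: mem)
  qed
  show ?thesis
    by (auto simp: iso_def hom_def bij_betw_def inj_on_def image_iff carrier)
qed

lemma carrier_sum_group_finite:
  assumes "finite I" "\<And>i. i \<in> I \<Longrightarrow> group (G i)"
  shows "carrier (sum_group I G) = (\<Pi>\<^sub>E i\<in>I. carrier (G i))"
  using assms by (auto simp: carrier_sum_group)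

context rooted_multigraph
begin

lemma laplacian_sym: "laplacian H u v = laplacian H v u"
  by (simp add: laplacian_def edges_between_def insert_commute)

text \<open>
  Each edge at \<open>u\<close> contributes 1 in the column of \<open>u\<close> and -1 in the column of its other end.
\<close>
lemma laplacian_row_sum:
  assumes "u \<in> mverts H"
  shows "(\<Sum>v\<in>mverts H. laplacian H u v) = 0"
proof -
  have "(\<Sum>v\<in>mverts H. if u = v then 1 else if v \<in> mends H e then - 1 else 0) = (0 :: int)"
    if e: "e \<in> incident u" for e
  proof -
    obtain w where w: "w \<in> mverts H" "w \<noteq> u" "mends H e = {u, w}" using other_end[OF e] .
    have "(\<Sum>v\<in>mverts H. if u = v then 1 else if v \<in> mends H e then - 1 else 0) =
        (\<Sum>v\<in>mverts H. (if u = v then 1 else 0) - (if w = v then 1 else 0 :: int))"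
      using w by (intro sum.cong) auto
    also have "\<dots> = 0" using assms w finite_mverts by (simp add: sum_subtractf)
    finally show ?thesis .
  qed
  then show ?thesis
    unfolding laplacian_sum_incident by (subst sum.swap) simp
qed

lemma laplacian_column_sum:
  "v \<in> mverts H \<Longrightarrow> (\<Sum>u\<in>mverts H. laplacian H u v) = 0"
  using laplacian_row_sum[of v] by (simp add: laplacian_sym)

context
  fixes vs :: "'v list"
  assumes distinct_vs: "distinct vs" and set_vs: "set vs = nonroot"
begin

lemma sum_mverts_split:
  "(\<Sum>u\<in>mverts H. g u) = g q + (\<Sum>j = 0..<length vs. g (vs ! j))" for g :: "'v \<Rightarrow> 'b :: comm_monoid_add"
proof -
  have "mverts H = insert q (set vs)" "q \<notin> set vs"
    using root_in_mverts by (auto simp: set_vs nonroot_def)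
  then have "(\<Sum>u\<in>mverts H. g u) = g q + (\<Sum>u\<in>set vs. g u)" by simp
  also have "(\<Sum>u\<in>set vs. g u) = (\<Sum>j = 0..<length vs. g (vs ! j))"
    using distinct_vs by (simp add: sum_list_distinct_conv_sum_set[symmetric] sum_list_sum_nth)
  finally show ?thesis .
qed

definition nonroot_vec :: "('v \<Rightarrow> int) \<Rightarrow> int vec" where
  "nonroot_vec x = vec (length vs) (\<lambda>j. x (vs ! j))"

lemma lattice_element_with_coordinates:
  assumes w: "w \<in> carrier_vec (length vs)"
  obtains x where "x \<in> carrier (int_lattice (mverts H))" "nonroot_vec x = w" "x q = a"
proof
  let ?idx = "inv_into {0..<length vs} ((!) vs)"
  let ?x = "\<lambda>u\<in>mverts H. if u = q then a else w $ ?idx u"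
  have inj: "inj_on ((!) vs) {0..<length vs}" using distinct_vs by (simp add: inj_on_nth)
  have nth: "vs ! j \<in> mverts H" "vs ! j \<noteq> q" if "j < length vs" for j
    using nth_mem[OF that] by (auto simp: set_vs nonroot_def)
  show "?x \<in> carrier (int_lattice (mverts H))" by (simp add: int_lattice_def)
  show "nonroot_vec ?x = w"
    using w by (intro eq_vecI) (auto simp: nonroot_vec_def nth inv_into_f_f[OF inj])
  show "?x q = a" using root_in_mverts by simp
qed

definition reduced_laplacian :: "int mat" where
  "reduced_laplacian = mat (length vs) (length vs) (\<lambda>(i, j). laplacian H (vs ! i) (vs ! j))"

definition laplacian_map :: "('v \<Rightarrow> int) \<Rightarrow> 'v \<Rightarrow> int" where
  "laplacian_map x = (\<lambda>u\<in>mverts H. \<Sum>v\<in>mverts H. laplacian H u v * x v)"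

lemma laplacian_image_eq: "laplacian_image H = laplacian_map ` carrier (int_lattice (mverts H))"
  by (simp add: laplacian_image_def laplacian_map_def)

lemma sum_laplacian_map: "(\<Sum>u\<in>mverts H. laplacian_map x u) = 0"
proof -
  have "(\<Sum>u\<in>mverts H. laplacian_map x u) = (\<Sum>v\<in>mverts H. (\<Sum>u\<in>mverts H. laplacian H u v) * x v)"
    by (simp add: laplacian_map_def sum_distrib_right) (rule sum.swap)
  then show ?thesis by (simp add: laplacian_column_sum)
qed

text \<open>
  As the Laplacian annihilates constant vectors, one may subtract the value at the root everywhere,
  after which the column of the root does not contribute.
\<close>
lemma nonroot_vec_laplacian_map:
  "nonroot_vec (laplacian_map x) = reduced_laplacian *\<^sub>v nonroot_vec (\<lambda>v. x v - x q)"
proof (rule eq_vecI)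
  show "dim_vec (nonroot_vec (laplacian_map x)) = dim_vec (reduced_laplacian *\<^sub>v nonroot_vec (\<lambda>v. x v - x q))"
    by (simp add: nonroot_vec_def reduced_laplacian_def)
  fix i assume "i < dim_vec (reduced_laplacian *\<^sub>v nonroot_vec (\<lambda>v. x v - x q))"
  then have i: "i < length vs" by (simp add: reduced_laplacian_def)
  then have u: "vs ! i \<in> mverts H" using nth_mem[OF i] by (auto simp: set_vs nonroot_def)
  have "(\<Sum>v\<in>mverts H. laplacian H (vs ! i) v * x v) =
      (\<Sum>v\<in>mverts H. laplacian H (vs ! i) v * (x v - x q)) + (\<Sum>v\<in>mverts H. laplacian H (vs ! i) v) * x q"
    by (simp add: algebra_simps sum_subtractf sum_distrib_left)
  also have "\<dots> = (\<Sum>j = 0..<length vs. laplacian H (vs ! i) (vs ! j) * (x (vs ! j) - x q))"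
    unfolding laplacian_row_sum[OF u] by (simp add: sum_mverts_split)
  finally show "nonroot_vec (laplacian_map x) $ i = (reduced_laplacian *\<^sub>v nonroot_vec (\<lambda>v. x v - x q)) $ i"
    using i u by (simp add: nonroot_vec_def laplacian_map_def reduced_laplacian_def scalar_prod_def)
qed

lemma lattice_eqI:
  assumes "x \<in> carrier (int_lattice (mverts H))" "y \<in> carrier (int_lattice (mverts H))"
    and vec: "nonroot_vec x = nonroot_vec y" and sum: "(\<Sum>u\<in>mverts H. x u) = (\<Sum>u\<in>mverts H. y u)"
  shows "x = y"
proof (rule PiE_ext)
  show "x \<in> Pi\<^sub>E (mverts H) (\<lambda>_. UNIV)" "y \<in> Pi\<^sub>E (mverts H) (\<lambda>_. UNIV)"
    using assms(1,2) by (simp_all add: int_lattice_def)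
  have nth: "x (vs ! j) = y (vs ! j)" if "j < length vs" for j
    using arg_cong[OF vec, of "\<lambda>w. w $ j"] that by (simp add: nonroot_vec_def)
  then have "x q = y q" using sum by (simp add: sum_mverts_split)
  moreover have "x u = y u" if "u \<in> set vs" for u
    using that nth by (metis in_set_conv_nth)
  ultimately show "x u = y u" if "u \<in> mverts H" for u
    using that by (cases "u = q") (auto simp: set_vs nonroot_def)
qed

context
  fixes P P' Q Q' :: "int mat" and f :: "nat \<Rightarrow> nat"
  assumes P: "P \<in> carrier_mat (length vs) (length vs)" and P': "P' \<in> carrier_mat (length vs) (length vs)"
    and Q: "Q \<in> carrier_mat (length vs) (length vs)" and Q': "Q' \<in> carrier_mat (length vs) (length vs)"
    and PP': "P * P' = 1\<^sub>m (length vs)" and P'P: "P' * P = 1\<^sub>m (length vs)"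
    and QQ': "Q * Q' = 1\<^sub>m (length vs)"
    and diag: "P * reduced_laplacian * Q = mat_diag (length vs) (\<lambda>i. int (f i))"
    and f_pos: "\<And>i. i < length vs \<Longrightarrow> f i > 0"
begin

lemma reduced_laplacian_carrier: "reduced_laplacian \<in> carrier_mat (length vs) (length vs)"
  by (simp add: reduced_laplacian_def)

lemma mat_diag_mult_vec:
  assumes "y \<in> carrier_vec (length vs)" "i < length vs"
  shows "(mat_diag (length vs) (\<lambda>i. int (f i)) *\<^sub>v y) $ i = int (f i) * y $ i"
  using assms by (simp add: mat_diag_def scalar_prod_def if_distrib[of "\<lambda>c. c * _"] cong: if_cong)

text \<open>
  Multiplication by \<open>P\<close> turns the image of the reduced Laplacian into the image of the diagonal matrix,
  because \<open>Q\<close>, being invertible over the integers, maps the integer vectors onto themselves.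
\<close>
lemma mem_range_reduced_laplacian_iff:
  assumes b: "b \<in> carrier_vec (length vs)"
  shows "(\<exists>w\<in>carrier_vec (length vs). b = reduced_laplacian *\<^sub>v w) \<longleftrightarrow>
    (\<forall>i<length vs. int (f i) dvd (P *\<^sub>v b) $ i)"
proof
  let ?n = "length vs" and ?A = reduced_laplacian and ?D = "mat_diag (length vs) (\<lambda>i. int (f i))"
  note A = reduced_laplacian_carrier
  have assoc: "P *\<^sub>v (?A *\<^sub>v (Q *\<^sub>v y)) = ?D *\<^sub>v y" if "y \<in> carrier_vec ?n" for y
    using that A P Q by (simp add: diag[symmetric] assoc_mult_mat_vec[of _ ?n ?n _ ?n])
  {
    assume "\<exists>w\<in>carrier_vec ?n. b = ?A *\<^sub>v w"
    then obtain w where w: "w \<in> carrier_vec ?n" "b = ?A *\<^sub>v w" by blast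
    have "Q *\<^sub>v (Q' *\<^sub>v w) = w"
      using w Q Q' by (simp add: assoc_mult_mat_vec[symmetric, of _ ?n ?n _ ?n] QQ')
    then have "P *\<^sub>v b = ?D *\<^sub>v (Q' *\<^sub>v w)"
      using w assoc[of "Q' *\<^sub>v w"] Q' by simp
    then show "\<forall>i<?n. int (f i) dvd (P *\<^sub>v b) $ i"
      using w Q' by (simp add: mat_diag_mult_vec)
  next
    assume dvd: "\<forall>i<?n. int (f i) dvd (P *\<^sub>v b) $ i"
    \<comment> \<open>the solution of the diagonal system; the divisions are exact\<close>
    define y where "y = vec ?n (\<lambda>i. (P *\<^sub>v b) $ i div int (f i))"
    have y: "y \<in> carrier_vec ?n" by (simp add: y_def)
    have "?D *\<^sub>v y = P *\<^sub>v b"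
    proof (rule eq_vecI)
      fix i assume "i < dim_vec (P *\<^sub>v b)"
      then have i: "i < ?n" using P by simp
      show "(?D *\<^sub>v y) $ i = (P *\<^sub>v b) $ i"
        unfolding mat_diag_mult_vec[OF y i] using dvd i by (simp add: y_def)
    qed (use P in \<open>simp add: mat_diag_def\<close>)
    then have eq: "P *\<^sub>v (?A *\<^sub>v (Q *\<^sub>v y)) = P *\<^sub>v b" using assoc[OF y] by simp
    have cancel: "P' *\<^sub>v (P *\<^sub>v z) = z" if "z \<in> carrier_vec ?n" for z
      using that P P' by (simp add: assoc_mult_mat_vec[symmetric, of _ ?n ?n _ ?n] P'P)
    have "?A *\<^sub>v (Q *\<^sub>v y) = b"
      using cancel[of "?A *\<^sub>v (Q *\<^sub>v y)"] cancel[OF b] eq A Q y by (metis mult_mat_vec_carrier)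
    then show "\<exists>w\<in>carrier_vec ?n. b = ?A *\<^sub>v w"
      using Q y by (metis mult_mat_vec_carrier)
  }
qed

definition invariant_map :: "('v \<Rightarrow> int) \<Rightarrow> int \<times> (nat \<Rightarrow> int)" where
  "invariant_map x =
     (\<Sum>u\<in>mverts H. x u, \<lambda>i\<in>{..<length vs}. (P *\<^sub>v nonroot_vec x) $ i mod int (f i))"

abbreviation "invariant_group \<equiv> sum_group {..<length vs} (\<lambda>i. integer_mod_group (f i))"

lemma invariant_map_hom:
  "invariant_map \<in> hom (int_lattice (mverts H)) (integer_group \<times>\<times> invariant_group)"
proof (rule homI)
  fix x y
  show "invariant_map x \<in> carrier (integer_group \<times>\<times> invariant_group)"
    using f_pos by (auto simp: invariant_map_def carrier_sum_group_finite carrier_integer_mod_group)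
  have nth: "vs ! j \<in> mverts H" if "j < length vs" for j
    using nth_mem[OF that] by (auto simp: set_vs nonroot_def)
  let ?z = "x \<otimes>\<^bsub>int_lattice (mverts H)\<^esub> y"
  have "nonroot_vec ?z = nonroot_vec x + nonroot_vec y"
    by (rule eq_vecI) (auto simp: nonroot_vec_def int_lattice_def nth)
  then have "P *\<^sub>v nonroot_vec ?z = P *\<^sub>v nonroot_vec x + P *\<^sub>v nonroot_vec y"
    using P by (simp add: mult_add_distrib_mat_vec[of _ "length vs" "length vs"] nonroot_vec_def)
  then show "invariant_map ?z = invariant_map x \<otimes>\<^bsub>integer_group \<times>\<times> invariant_group\<^esub> invariant_map y"
    using P by (auto simp: invariant_map_def int_lattice_def sum.distrib mod_add_eq intro!: restrict_ext)
qed

text \<open>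
  The non-root coordinates are found by inverting \<open>P\<close>; the coordinate at the root is then free to
  produce the required sum.
\<close>
lemma invariant_map_surj:
  "invariant_map ` carrier (int_lattice (mverts H)) = carrier (integer_group \<times>\<times> invariant_group)"
proof
  show "invariant_map ` carrier (int_lattice (mverts H)) \<subseteq> carrier (integer_group \<times>\<times> invariant_group)"
    by (rule hom_carrier[OF invariant_map_hom])
  show "carrier (integer_group \<times>\<times> invariant_group) \<subseteq> invariant_map ` carrier (int_lattice (mverts H))"
  proof
    fix sc assume "sc \<in> carrier (integer_group \<times>\<times> invariant_group)"
    then obtain s c where sc: "sc = (s, c)" and c: "c \<in> (\<Pi>\<^sub>E i\<in>{..<length vs}. carrier (integer_mod_group (f i)))"
      by (auto simp: carrier_sum_group_finite)
    define w where "w = P' *\<^sub>v vec (length vs) c"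
    have w: "w \<in> carrier_vec (length vs)" using P' by (simp add: w_def)
    obtain x where x: "x \<in> carrier (int_lattice (mverts H))" "nonroot_vec x = w"
      "x q = s - (\<Sum>j = 0..<length vs. w $ j)"
      using lattice_element_with_coordinates[OF w] .
    have "x (vs ! j) = w $ j" if "j < length vs" for j
      using that x(2) by (auto simp: nonroot_vec_def)
    then have "(\<Sum>u\<in>mverts H. x u) = s" by (simp add: sum_mverts_split x(3))
    moreover have "P *\<^sub>v nonroot_vec x = vec (length vs) c"
      using P P' by (simp add: x(2) w_def assoc_mult_mat_vec[symmetric, of _ "length vs" "length vs" _ "length vs"] PP')
    moreover have "c i mod int (f i) = c i" if "i < length vs" for i
      using PiE_mem[OF c, of i] f_pos[OF that] that by (simp add: carrier_integer_mod_group)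
    ultimately have "invariant_map x = (s, \<lambda>i\<in>{..<length vs}. c i)"
      by (auto simp: invariant_map_def intro!: restrict_ext)
    also have "(\<lambda>i\<in>{..<length vs}. c i) = c" using c by (simp add: PiE_restrict)
    finally show "sc \<in> invariant_map ` carrier (int_lattice (mverts H))" using x(1) sc by force
  qed
qed

text \<open>
  A vector with coordinate sum zero is determined by its non-root part, so it lies in the image of the
  Laplacian as soon as its non-root part lies in the image of the reduced one.
\<close>
lemma invariant_map_kernel:
  "kernel (int_lattice (mverts H)) (integer_group \<times>\<times> invariant_group) invariant_map = laplacian_image H"
proof -
  have one: "invariant_map x = \<one>\<^bsub>integer_group \<times>\<times> invariant_group\<^esub> \<longleftrightarrow>
      (\<Sum>u\<in>mverts H. x u) = 0 \<and> (\<exists>w\<in>carrier_vec (length vs). nonroot_vec x = reduced_laplacian *\<^sub>v w)" for x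
  proof -
    have "(\<lambda>i\<in>{..<length vs}. (P *\<^sub>v nonroot_vec x) $ i mod int (f i)) = (\<lambda>i\<in>{..<length vs}. 0) \<longleftrightarrow>
        (\<forall>i<length vs. int (f i) dvd (P *\<^sub>v nonroot_vec x) $ i)"
      by (auto simp: fun_eq_iff dvd_eq_mod_eq_0 restrict_def)
    then show ?thesis
      by (subst mem_range_reduced_laplacian_iff) (auto simp: invariant_map_def nonroot_vec_def)
  qed
  have map_carrier: "laplacian_map z \<in> carrier (int_lattice (mverts H))" for z
    by (simp add: laplacian_map_def int_lattice_def)
  have "x \<in> laplacian_image H \<longleftrightarrow> x \<in> carrier (int_lattice (mverts H)) \<and> (\<Sum>u\<in>mverts H. x u) = 0 \<and>
      (\<exists>w\<in>carrier_vec (length vs). nonroot_vec x = reduced_laplacian *\<^sub>v w)" (is "_ = ?R x") for x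
  proof
    assume "x \<in> laplacian_image H"
    then obtain z where "x = laplacian_map z" by (auto simp: laplacian_image_eq)
    moreover have "nonroot_vec (\<lambda>v. z v - z q) \<in> carrier_vec (length vs)" by (simp add: nonroot_vec_def)
    ultimately show "?R x" using map_carrier sum_laplacian_map nonroot_vec_laplacian_map by blast
  next
    assume R: "?R x"
    then obtain w where w: "w \<in> carrier_vec (length vs)" "nonroot_vec x = reduced_laplacian *\<^sub>v w" by blast
    obtain z where z: "z \<in> carrier (int_lattice (mverts H))" "nonroot_vec z = w" "z q = 0"
      using lattice_element_with_coordinates[OF w(1)] .
    have "nonroot_vec (laplacian_map z) = nonroot_vec x"
      using z w(2) by (simp add: nonroot_vec_laplacian_map)
    then have "laplacian_map z = x"
      using R map_carrier sum_laplacian_map by (intro lattice_eqI) auto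
    then show "x \<in> laplacian_image H" using z(1) by (auto simp: laplacian_image_eq)
  qed
  then show ?thesis unfolding kernel_def one by blast
qed

theorem sandpile_group_iso_invariant_group: "sandpile_group H \<cong> invariant_group"
proof -
  let ?L = "int_lattice (mverts H)" and ?C = "integer_group \<times>\<times> invariant_group"
  have groups: "group ?L" "group invariant_group" "group ?C"
    by (auto simp: int_lattice_def intro!: DirProd_group)
  interpret group_hom ?L ?C invariant_map
    using groups invariant_map_hom by (simp add: group_hom_def group_hom_axioms_def)
  have "(\<lambda>X. the_elem (invariant_map ` X)) \<in> iso (?L Mod laplacian_image H) ?C"
    using FactGroup_iso_set[OF invariant_map_surj] by (simp add: invariant_map_kernel)
  moreover have "group (?L Mod laplacian_image H)"
    using normal.factorgroup_is_group[OF normal_kernel] by (simp add: invariant_map_kernel)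
  ultimately have "sandpile_group H \<cong> torsion_part ?C"
    unfolding sandpile_group_def using torsion_part_iso groups(3) by (blast intro: is_isoI)
  moreover have "finite (carrier invariant_group)"
    using f_pos by (auto simp: carrier_sum_group_finite carrier_integer_mod_group intro!: finite_PiE)
  then have "torsion_part ?C \<cong> invariant_group"
    using torsion_part_int_times_finite groups(2) by (blast intro: is_isoI)
  ultimately show ?thesis by (rule iso_trans)
qed

end

end

end

section \<open>The coned multigraph of a connected graph\<close>

context
  fixes G :: "'a pair_pre_digraph"
  assumes pair_graph: "pair_graph G" and connected: "Digraph_Component.connected (with_proj G)"
begin

interpretation pair_graph G by (rule pair_graph)

lemma reachable_all:
  assumes "u \<in> pverts G" "v \<in> pverts G"
  shows "u \<rightarrow>\<^sup>*\<^bsub>with_proj G\<^esub> v"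
  using connected assms reachable_mk_symmetric_eq[OF pair_sym_arcs]
  by (simp add: connected_def strongly_connected_def)

lemma shortest_apath:
  assumes "u \<in> pverts G" "v \<in> pverts G"
  obtains p where "apath u p v" "length p = graph_dist G u v"
proof -
  have "\<exists>k p. apath u p v \<and> length p = k"
    using reachable_all[OF assms] by (auto simp: reachable_apath)
  then have "\<exists>p. apath u p v \<and> length p = graph_dist G u v"
    unfolding graph_dist_def by (rule LeastI_ex)
  then show thesis using that by blast
qed

lemma graph_dist_pos:
  assumes "u \<in> pverts G" "v \<in> pverts G" "u \<noteq> v"
  shows "graph_dist G u v > 0"
proof -
  obtain p where "apath u p v" "length p = graph_dist G u v"
    using shortest_apath[OF assms(1,2)] .
  then show ?thesis using assms(3) by (cases p) (auto simp: apath_Nil_iff)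
qed

lemma card_neighbours: "deg G u = card {v \<in> pverts G. (u, v) \<in> parcs G}"
proof -
  have "out_arcs (with_proj G) u = Pair u ` {v \<in> pverts G. (u, v) \<in> parcs G}"
    using arc_snd_in_verts by (force simp: out_arcs_def)
  then show ?thesis by (simp add: out_degree_def card_image inj_on_def)
qed

lemma adjacency_le_graph_dist:
  assumes "u \<in> pverts G" "v \<in> pverts G"
  shows "(if (u, v) \<in> parcs G then 1 else 0) \<le> graph_dist G u v"
  using graph_dist_pos[OF assms] pair_no_loops[of "(u, v)"] by auto

lemma deg_eq_sum: "deg G u = (\<Sum>v\<in>pverts G. if (u, v) \<in> parcs G then 1 else 0)"
  by (simp add: card_neighbours sum.If_cases[OF pair_finite_verts] Int_def)

lemma deg_le_trs: "u \<in> pverts G \<Longrightarrow> deg G u \<le> trs G u"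
  unfolding deg_eq_sum trs_def by (intro sum_mono adjacency_le_graph_dist)

text \<open>
  In the comparison of \<open>deg u\<close> and \<open>trs u\<close> as sums over all vertices, a vertex \<open>v\<close> that is neither \<open>u\<close>
  nor adjacent to \<open>u\<close> contributes 0 to the former and a positive distance to the latter.
\<close>
lemma deg_less_trs:
  assumes "u \<in> pverts G" "v \<in> pverts G" "u \<noteq> v" "(u, v) \<notin> parcs G"
  shows "deg G u < trs G u"
  unfolding deg_eq_sum trs_def
  using assms graph_dist_pos[OF assms(1-3)]
  by (intro sum_strict_mono_ex1 pair_finite_verts ballI adjacency_le_graph_dist bexI[of _ v]) auto

lemma not_complete_obtains_vertex:
  assumes "\<not> complete_digraph (card (pverts G)) (with_proj G)"
  obtains u where "u \<in> pverts G" "deg G u < trs G u"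
proof -
  have "parcs G \<subseteq> {(u, v). (u, v) \<in> pverts G \<times> pverts G \<and> u \<noteq> v}"
    using arc_fst_in_verts arc_snd_in_verts pair_no_loops by fastforce
  moreover have "parcs G \<noteq> {(u, v). (u, v) \<in> pverts G \<times> pverts G \<and> u \<noteq> v}"
    using assms by (simp add: complete_digraph_def graph_axioms)
  ultimately obtain u v where "u \<in> pverts G" "v \<in> pverts G" "u \<noteq> v" "(u, v) \<notin> parcs G" by blast
  then show thesis using deg_less_trs that by blast
qed

lemma rooted_multigraph_cone: "rooted_multigraph (cone_multigraph G) None"
proof
  show "finite (mverts (cone_multigraph G))"
    by (simp add: cone_multigraph_def pair_finite_verts)
  have "finite {Inl {u, v} :: 'a set + 'a \<times> nat | u v. (u, v) \<in> parcs G}"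
    by (rule finite_subset[of _ "(\<lambda>(u, v). Inl {u, v}) ` parcs G"]) (auto simp: pair_finite_arcs)
  moreover have "finite {Inr (v, k) :: 'a set + 'a \<times> nat | v k. v \<in> pverts G \<and> k < trs G v - deg G v}"
    by (rule finite_subset[of _ "Inr ` (SIGMA v:pverts G. {..<trs G v - deg G v})"])
       (auto simp: pair_finite_verts)
  ultimately show "finite (medges (cone_multigraph G))"
    by (simp add: cone_multigraph_def)
  show "None \<in> mverts (cone_multigraph G)" by (simp add: cone_multigraph_def)
  fix e assume e: "e \<in> medges (cone_multigraph G)"
  show "\<exists>u\<in>mverts (cone_multigraph G). \<exists>v\<in>mverts (cone_multigraph G).
      u \<noteq> v \<and> mends (cone_multigraph G) e = {u, v}"
  proof (cases e)
    case (Inl s)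
    then obtain u v where uv: "(u, v) \<in> parcs G" "s = {u, v}" using e by (auto simp: cone_multigraph_def)
    then have "u \<in> pverts G" "v \<in> pverts G" "u \<noteq> v"
      using arc_fst_in_verts[OF uv(1)] arc_snd_in_verts[OF uv(1)] pair_no_loops[OF uv(1)] by auto
    then show ?thesis
      using uv Inl by (intro bexI[of _ "Some u"] bexI[of _ "Some v"]) (auto simp: cone_multigraph_def)
  next
    case (Inr vk)
    then obtain v k where "v \<in> pverts G" "vk = (v, k)" using e by (auto simp: cone_multigraph_def)
    then show ?thesis
      using Inr by (intro bexI[of _ None] bexI[of _ "Some v"]) (auto simp: cone_multigraph_def)
  qed
qed

lemma cone_edge_cases:
  "e \<in> medges (cone_multigraph G) \<longleftrightarrow>
    (\<exists>u v. e = Inl {u, v} \<and> (u, v) \<in> parcs G) \<or> (\<exists>v k. e = Inr (v, k) \<and> v \<in> pverts G \<and> k < trs G v - deg G v)"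
  by (auto simp: cone_multigraph_def)

lemma mends_cone [simp]:
  "mends (cone_multigraph G) (Inl s) = Some ` s"
  "mends (cone_multigraph G) (Inr (v, k)) = {None, Some v}"
  by (simp_all add: cone_multigraph_def)

lemma parcs_commute: "(u, v) \<in> parcs G \<longleftrightarrow> (v, u) \<in> parcs G"
  using pair_sym_arcs by (auto simp: symmetric_def sym_def)

lemma edges_between_cone:
  assumes "u \<noteq> v"
  shows "edges_between (cone_multigraph G) (Some u) (Some v) = (if (u, v) \<in> parcs G then {Inl {u, v}} else {})"
proof -
  have "Some ` s = {Some u, Some v} \<longleftrightarrow> s = {u, v}" for s
    using inj_image_eq_iff[of Some s "{u, v}"] by simp
  then show ?thesis
    using parcs_commute by (auto simp: edges_between_def cone_edge_cases doubleton_eq_iff)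
qed

lemma mdegree_cone:
  assumes "u \<in> pverts G"
  shows "mdegree (cone_multigraph G) (Some u) = trs G u"
proof -
  let ?N = "{v \<in> pverts G. (u, v) \<in> parcs G}"
  have "{e \<in> medges (cone_multigraph G). Some u \<in> mends (cone_multigraph G) e} =
      (\<lambda>v. Inl {u, v}) ` ?N \<union> (\<lambda>k. Inr (u, k)) ` {..<trs G u - deg G u}" (is "?L = ?R")
  proof
    show "?L \<subseteq> ?R"
    proof
      fix e assume e: "e \<in> ?L"
      then consider (arc) x y where "e = Inl {x, y}" "(x, y) \<in> parcs G"
        | (cone) x k where "e = Inr (x, k)" "k < trs G x - deg G x"
        by (auto simp: cone_edge_cases)
      then show "e \<in> ?R"
      proof cases
        case arc
        then have "u = x \<or> u = y" using e by auto
        then obtain v where "e = Inl {u, v}" "(u, v) \<in> parcs G"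
          using arc parcs_commute by (metis insert_commute)
        then show ?thesis using arc_snd_in_verts by force
      next
        case cone
        then show ?thesis using e by auto
      qed
    qed
    show "?R \<subseteq> ?L" using assms by (auto simp: cone_edge_cases)
  qed
  moreover have "card ((\<lambda>v. Inl {u, v} :: 'a set + 'a \<times> nat) ` ?N) = deg G u"
    by (subst card_image) (auto simp: inj_on_def doubleton_eq_iff card_neighbours)
  moreover have "card ((\<lambda>k. Inr (u, k) :: 'a set + 'a \<times> nat) ` {..<trs G u - deg G u}) = trs G u - deg G u"
    by (subst card_image) (auto simp: inj_on_def)
  moreover have "card ((\<lambda>v. Inl {u, v}) ` ?N \<union> (\<lambda>k. Inr (u, k)) ` {..<trs G u - deg G u}) =
      card ((\<lambda>v. Inl {u, v} :: 'a set + 'a \<times> nat) ` ?N) +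
      card ((\<lambda>k. Inr (u, k) :: 'a set + 'a \<times> nat) ` {..<trs G u - deg G u})"
    using pair_finite_verts by (intro card_Un_disjoint) auto
  ultimately show ?thesis using deg_le_trs[OF assms] by (simp add: mdegree_def)
qed

text \<open>
  All vertices of \<open>G\<close> are connected with each other, and one of them is joined to the cone
  vertex because its transmission exceeds its degree.
\<close>
lemma cone_connected:
  assumes "\<not> complete_digraph (card (pverts G)) (with_proj G)"
  shows "mconnected (cone_multigraph G)"
proof -
  let ?R = "{(x, y). edges_between (cone_multigraph G) x y \<noteq> {}}"
  have "sym ?R" by (auto simp: sym_def edges_between_def insert_commute)
  then have sym: "sym (?R\<^sup>*)" by (rule sym_rtrancl)
  obtain w where w: "w \<in> pverts G" "deg G w < trs G w"
    using not_complete_obtains_vertex[OF assms] .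
  then have "Inr (w, 0) \<in> edges_between (cone_multigraph G) (Some w) None"
    by (auto simp: edges_between_def cone_edge_cases)
  then have root: "(Some w, None) \<in> ?R" by blast
  have arc: "(Some u, Some v) \<in> ?R" if "(u, v) \<in> parcs G" for u v
  proof -
    have "Inl {u, v} \<in> edges_between (cone_multigraph G) (Some u) (Some v)"
      using that by (auto simp: edges_between_def cone_edge_cases)
    then show ?thesis by blast
  qed
  have arcs: "(Some u, Some v) \<in> ?R\<^sup>*" if "(u, v) \<in> (parcs G)\<^sup>*" for u v
    using that
  proof (induction rule: rtrancl_induct)
    case (step y z)
    from step.IH arc[OF step.hyps(2)] show ?case by (rule rtrancl_into_rtrancl)
  qed simp
  have "(u, w) \<in> (parcs G)\<^sup>*" if "u \<in> pverts G" for u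
    using reachable_rtranclI[OF reachable_all[OF that w(1)]] by simp
  then have to_root: "(Some u, None) \<in> ?R\<^sup>*" if "u \<in> pverts G" for u
    using arcs[of u w] that root by (blast intro: rtrancl_into_rtrancl)
  have "(x, None) \<in> ?R\<^sup>*" if "x \<in> mverts (cone_multigraph G)" for x
  proof (cases x)
    case (Some u)
    then have "u \<in> pverts G" using that by (simp add: cone_multigraph_def image_iff)
    then show ?thesis unfolding Some by (rule to_root)
  qed simp
  then have "(x, y) \<in> ?R\<^sup>*" if "x \<in> mverts (cone_multigraph G)" "y \<in> mverts (cone_multigraph G)" for x y
    using that sym by (meson rtrancl_trans symD)
  then show ?thesis by (auto simp: mconnected_def cone_multigraph_def)
qed

lemma A_trs_eq_laplacian_cone:
  assumes "distinct vs" "set vs = pverts G"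
  shows "A_trs G vs = mat (length vs) (length vs) (\<lambda>(i, j). laplacian (cone_multigraph G) (Some (vs ! i)) (Some (vs ! j)))"
proof (rule eq_matI, goal_cases)
  case (1 i j)
  then have ij: "i < length vs" "j < length vs" by simp_all
  then have "vs ! i \<in> pverts G" using assms(2) nth_mem by blast
  moreover have "(vs ! i, vs ! i) \<notin> parcs G" using pair_no_loops by force
  moreover have "vs ! i = vs ! j \<longleftrightarrow> i = j" using ij assms(1) by (simp add: nth_eq_iff_index_eq)
  ultimately show ?case
    using ij by (auto simp: A_trs_def trs_mat_def adjacency_mat_def mat_diag_def laplacian_def
        mdegree_cone edges_between_cone)
qed (simp_all add: A_trs_def trs_mat_def adjacency_mat_def)

end

lemma invertible_mat_obtains_inverse:
  assumes "invertible_mat P" "P \<in> carrier_mat n n"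
  obtains P' where "P' \<in> carrier_mat n n" "P * P' = 1\<^sub>m n" "P' * P = 1\<^sub>m n"
proof -
  obtain B where B: "P * B = 1\<^sub>m n" "B * P = 1\<^sub>m (dim_row B)"
    using assms by (auto simp: invertible_mat_def inverts_mat_def)
  have "B \<in> carrier_mat n n"
    using arg_cong[OF B(1), of dim_col] arg_cong[OF B(2), of dim_col] assms(2) by auto
  then show thesis using that B by auto
qed

lemma abs_det_invertible_int_mat:
  fixes P :: "int mat"
  assumes "invertible_mat P" "P \<in> carrier_mat n n"
  shows "\<bar>det P\<bar> = 1"
proof -
  obtain P' where P': "P' \<in> carrier_mat n n" "P * P' = 1\<^sub>m n"
    using invertible_mat_obtains_inverse[OF assms] .
  then have "det P * det P' = 1" using det_mult[OF assms(2) P'(1)] by simp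
  then show ?thesis by (metis abs_zmult_eq_1 abs_1)
qed

lemma det_mat_diag: "det (mat_diag n d) = (\<Prod>i<n. d i)" for d :: "nat \<Rightarrow> 'a :: comm_ring_1"
  by (subst det_upper_triangular[of _ n])
     (auto simp: mat_diag_def prod_list_diag_prod lessThan_atLeast0)

theorem theorem3p1:
  fixes G :: "'a pair_pre_digraph" and n :: nat and vs :: "'a list" and f :: "nat \<Rightarrow> nat"
  assumes "pair_graph G"
    and "Digraph_Component.connected (with_proj G)"
    and "card (pverts G) = n"
    and "\<not> complete_digraph n (with_proj G)"
    and "distinct vs" and "set vs = pverts G"
    and "is_smith_normal_form (A_trs G vs) (mat_diag n (\<lambda>i. int (f i)))"
  shows "sandpile_group (cone_multigraph G) \<cong>
           sum_group {..<n} (\<lambda>i. integer_mod_group (f i))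
         \<and> num_spanning_trees (cone_multigraph G) = (\<Prod>i<n. f i)"
proof -
  let ?H = "cone_multigraph G" and ?ws = "map Some vs"
  interpret H: rooted_multigraph ?H None
    by (rule rooted_multigraph_cone[OF assms(1,2)])
  have n: "length vs = n" using assms(3,5,6) distinct_card by fastforce
  have ws: "distinct ?ws" "set ?ws = H.nonroot"
    unfolding H.nonroot_def using assms(5,6) by (auto simp: distinct_map cone_multigraph_def)
  have A: "A_trs G vs = mat (length ?ws) (length ?ws) (\<lambda>(i, j). laplacian ?H (?ws ! i) (?ws ! j))"
    unfolding A_trs_eq_laplacian_cone[OF assms(1,2,5,6)] by (rule eq_matI) auto
  have Ac: "A_trs G vs \<in> carrier_mat n n" by (simp add: A n)
  obtain P Q where P: "P \<in> carrier_mat n n" "invertible_mat P"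
    and Q: "Q \<in> carrier_mat n n" "invertible_mat Q"
    and D: "mat_diag n (\<lambda>i. int (f i)) = P * A_trs G vs * Q"
    using assms(7) Ac unfolding is_smith_normal_form_def Let_def by auto
  have "(\<Prod>i<n. int (f i)) = det P * det (A_trs G vs) * det Q"
    using det_mult[of "P * A_trs G vs" n Q] det_mult[of P n "A_trs G vs"] P(1) Q(1) Ac
    by (simp flip: det_mat_diag add: D)
  also have "det (A_trs G vs) = int (num_spanning_trees ?H)"
    unfolding A by (rule H.matrix_tree[OF ws])
  finally have "\<bar>\<Prod>i<n. int (f i)\<bar> = int (num_spanning_trees ?H)"
    by (simp add: abs_mult abs_det_invertible_int_mat[OF P(2,1)] abs_det_invertible_int_mat[OF Q(2,1)])
  then have count: "num_spanning_trees ?H = (\<Prod>i<n. f i)"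
    by (simp flip: of_nat_prod)
  have "num_spanning_trees ?H > 0"
    using H.num_spanning_trees_pos cone_connected[OF assms(1,2)] assms(3,4) by blast
  then have f_pos: "f i > 0" if "i < n" for i
    using that by (auto simp: count)
  obtain P' where P': "P' \<in> carrier_mat n n" "P * P' = 1\<^sub>m n" "P' * P = 1\<^sub>m n"
    using invertible_mat_obtains_inverse[OF P(2,1)] .
  obtain Q' where Q': "Q' \<in> carrier_mat n n" "Q * Q' = 1\<^sub>m n"
    using invertible_mat_obtains_inverse[OF Q(2,1)] .
  have "H.reduced_laplacian ?ws = A_trs G vs"
    unfolding A by (rule H.reduced_laplacian_def[OF ws])
  then have "sandpile_group ?H \<cong> sum_group {..<length ?ws} (\<lambda>i. integer_mod_group (f i))"
    by (intro H.sandpile_group_iso_invariant_group[OF ws, of P P' Q Q'])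
       (use P P' Q Q' D f_pos in \<open>simp_all add: n\<close>)
  then show ?thesis using count n by simp
qed

end
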